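(* Let $S$ be a multiplicative subset of a ring $R$. Then the following statements hold: (1) Let $0\to A\xrightarrow{f} B\xrightarrow{g} C\to 0$ be a $u$-$S$-split $u$-$S$-exact sequence of $R$-modules. If $B$ is $u$-$S$-pseudo-projective, then so are $A$ and $C$. (2) For $R$-modules $A$ and $B$, if $A\oplus B$ is $u$-$S$-pseudo-projective, then so are $A$ and $B$. (3) Let $f:A\to B$ be a $u$-$S$-isomorphism of $R$-modules. Then $A$ is $u$-$S$-pseudo-projective if and only if $B$ is $u$-$S$-pseudo-projective. (4) If $A$ is a $u$-$S$-pseudo-projective $R$-module, then any $u$-$S$-epimorphism $f:A\to A$ $u$-$S$-splits.
   Context: All rings are commutative with nonzero identity and all modules are unitary. A multiplicative subset $S$ of a ring $R$ is a nonempty subset with $1\in S$, $0\notin S$, and $s_1s_2\in S$ for all $s_1,s_2\in S$. An $R$-module $U$ is $u$-$S$-torsion if $sU=0$ for some $s\in S$. An $R$-homomorphism is a $u$-$S$-monomorphism (resp. $u$-$S$-epimorphism) if its kernel (resp. cokernel) is $u$-$S$-torsion, and a $u$-$S$-isomorphism if it is both. A sequence $A\xrightarrow{f}B\xrightarrow{g}C$ of $R$-modules is $u$-$S$-exact if there is $s\in S$ with $s\,\mathrm{Ker}(g)\subseteq \mathrm{Im}(f)$ and $s\,\mathrm{Im}(f)\subseteq \mathrm{Ker}(g)$; a sequence $0\to A\to B\to C\to 0$ is $u$-$S$-exact if it is so at each of $A$, $B$, $C$. A $u$-$S$-exact sequence $0\to A\xrightarrow{f}B\xrightarrow{g}C\to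 0$ is $u$-$S$-split if there are $s\in S$ and an $R$-homomorphism $f':B\to A$ with $f'f=s1_A$; equivalently, there are $t\in S$ and an $R$-homomorphism $g':C\to B$ with $gg'=t1_C$. A $u$-$S$-epimorphism $f:A\to B$ is said to $u$-$S$-split if the $u$-$S$-exact sequence $0\to \mathrm{Ker}(f)\to A\xrightarrow{f}B\to 0$ is $u$-$S$-split. An $R$-module $P$ is $u$-$S$-pseudo-projective if for any submodule $K$ of $P$ there is $s\in S$ such that for any $u$-$S$-epimorphism $f:P\to P/K$, $sf$ can be lifted to an endomorphism of $P$, i.e. there is $g\in \mathrm{End}_R(P)$ with $sf=\eta_K g$, where $\eta_K:P\to P/K$ is the natural map. *)

theory Defs
  imports "HOL-Algebra.AbelCoset" "HOL-Algebra.Module"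
begin

section \<open>Modules: homomorphisms, quotients, direct sums, the zero module\<close>

text \<open>
  Homomorphisms are only constrained on the carrier of their domain. Kernels are the library's
  \<open>a_kernel\<close>, images are \<open>f ` carrier M\<close>, and a submodule \<open>K\<close> of \<open>M\<close> is regarded as a module via
  \<open>M\<lparr>carrier := K\<rparr>\<close>. The library's module record extends the ring record; its fields \<open>mult\<close> and
  \<open>one\<close> carry no meaning for modules and are left undefined below.
\<close>

definition module_hom ::
  "('r, 'x) ring_scheme \<Rightarrow> ('r, 'a, 'm) module_scheme \<Rightarrow> ('r, 'b, 'n) module_scheme \<Rightarrow> ('a \<Rightarrow> 'b) set"
  where "module_hom R M N = {f. f \<in> carrier M \<rightarrow> carrier N \<and>
    (\<forall>x\<in>carrier M. \<forall>y\<in>carrier M. f (x \<oplus>\<^bsub>M\<^esub> y) = f x \<oplus>\<^bsub>N\<^esub> f y) \<and>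
    (\<forall>r\<in>carrier R. \<forall>x\<in>carrier M. f (r \<odot>\<^bsub>M\<^esub> x) = r \<odot>\<^bsub>N\<^esub> f x)}"

text \<open>
  The scalar product of \<open>r\<close> with a coset \<open>X\<close> follows the pattern of the library's \<open>rcoset_mult\<close>;
  see \<open>smult_FactModule\<close> below for its value \<open>K + r x\<close> on the coset \<open>K + x\<close>.
\<close>

definition FactModule :: "('r, 'a, 'm) module_scheme \<Rightarrow> 'a set \<Rightarrow> ('r, 'a set) module"
  where "FactModule M K =
    \<lparr>carrier = a_rcosets\<^bsub>M\<^esub> K, mult = undefined, one = undefined,
     zero = K, add = (<+>\<^bsub>M\<^esub>),
     smult = (\<lambda>r X. \<Union>x\<in>X. K +>\<^bsub>M\<^esub> (r \<odot>\<^bsub>M\<^esub> x))\<rparr>"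

definition direct_sum ::
  "('r, 'a, 'm) module_scheme \<Rightarrow> ('r, 'b, 'n) module_scheme \<Rightarrow> ('r, 'a \<times> 'b) module"
  where "direct_sum M N =
    \<lparr>carrier = carrier M \<times> carrier N, mult = undefined, one = undefined,
     zero = (\<zero>\<^bsub>M\<^esub>, \<zero>\<^bsub>N\<^esub>), add = (\<lambda>(x, y) (x', y'). (x \<oplus>\<^bsub>M\<^esub> x', y \<oplus>\<^bsub>N\<^esub> y')),
     smult = (\<lambda>r (x, y). (r \<odot>\<^bsub>M\<^esub> x, r \<odot>\<^bsub>N\<^esub> y))\<rparr>"

definition zero_module :: "('r, unit) module"
  where "zero_module =
    \<lparr>carrier = {()}, mult = undefined, one = undefined,
     zero = (), add = (\<lambda>_ _. ()), smult = (\<lambda>_ _. ())\<rparr>"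

lemma submodule_abelian_subgroup:
  assumes "module R M" "submodule K R M"
  shows "abelian_subgroup K M"
proof -
  interpret module R M by fact
  show ?thesis
    by (rule abelian_subgroupI3)
      (use assms(2) in \<open>auto simp: additive_subgroup_def submodule_def M.abelian_group_axioms\<close>)
qed

lemma carrier_FactModule: "carrier (FactModule M K) = (\<lambda>x. K +>\<^bsub>M\<^esub> x) ` carrier M"
  by (auto simp: FactModule_def A_RCOSETS_def')

lemma add_FactModule:
  assumes "module R M" "submodule K R M" "x \<in> carrier M" "y \<in> carrier M"
  shows "(K +>\<^bsub>M\<^esub> x) \<oplus>\<^bsub>FactModule M K\<^esub> (K +>\<^bsub>M\<^esub> y) = K +>\<^bsub>M\<^esub> (x \<oplus>\<^bsub>M\<^esub> y)"
  using abelian_subgroup.a_rcos_sum[OF submodule_abelian_subgroup[OF assms(1,2)] assms(3,4)]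
  by (simp add: FactModule_def)

lemma smult_FactModule:
  assumes M: "module R M" and K: "submodule K R M" and r: "r \<in> carrier R" and x: "x \<in> carrier M"
  shows "r \<odot>\<^bsub>FactModule M K\<^esub> (K +>\<^bsub>M\<^esub> x) = K +>\<^bsub>M\<^esub> (r \<odot>\<^bsub>M\<^esub> x)"
proof -
  interpret module R M by fact
  interpret K: abelian_subgroup K M by (rule submodule_abelian_subgroup[OF M K])
  have coset: "K +>\<^bsub>M\<^esub> (r \<odot>\<^bsub>M\<^esub> y) = K +>\<^bsub>M\<^esub> (r \<odot>\<^bsub>M\<^esub> x)" if y: "y \<in> K +>\<^bsub>M\<^esub> x" for y
  proof -
    obtain k where k: "k \<in> K" "y = k \<oplus>\<^bsub>M\<^esub> x"
      using y by (auto simp: a_r_coset_def')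
    have kc: "k \<in> carrier M" using k(1) K.a_subset by blast
    have "r \<odot>\<^bsub>M\<^esub> y = r \<odot>\<^bsub>M\<^esub> k \<oplus>\<^bsub>M\<^esub> r \<odot>\<^bsub>M\<^esub> x"
      by (simp add: k(2) kc r smult_r_distr x)
    moreover have "r \<odot>\<^bsub>M\<^esub> k \<in> K"
      using submodule.smult_closed[OF K r k(1)] .
    ultimately have mem: "r \<odot>\<^bsub>M\<^esub> y \<in> K +>\<^bsub>M\<^esub> (r \<odot>\<^bsub>M\<^esub> x)"
      by (auto simp: a_r_coset_def')
    have "r \<odot>\<^bsub>M\<^esub> x \<in> carrier M"
      using r x by simp
    from M.a_repr_independence[OF mem this K.a_subgroup] show ?thesis
      by (rule sym)
  qed
  have "x \<in> K +>\<^bsub>M\<^esub> x"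
    using K.a_rcos_self[OF x] .
  moreover have "(\<Union>y\<in>K +>\<^bsub>M\<^esub> x. K +>\<^bsub>M\<^esub> (r \<odot>\<^bsub>M\<^esub> y)) =
      (\<Union>y\<in>K +>\<^bsub>M\<^esub> x. K +>\<^bsub>M\<^esub> (r \<odot>\<^bsub>M\<^esub> x))"
    by (rule SUP_cong[OF refl coset])
  ultimately show ?thesis
    unfolding FactModule_def by auto
qed

lemma FactModule_is_module:
  assumes M: "module R M" and K: "submodule K R M"
  shows "module R (FactModule M K)"
proof -
  interpret module R M by fact
  interpret K: abelian_subgroup K M by (rule submodule_abelian_subgroup[OF M K])
  have zero: "\<zero>\<^bsub>FactModule M K\<^esub> = K +>\<^bsub>M\<^esub> \<zero>\<^bsub>M\<^esub>"
    using M.a_coset_add_zero[OF K.a_subset] by (simp add: FactModule_def)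
  note [simp] = carrier_FactModule add_FactModule[OF M K] smult_FactModule[OF M K] zero
  show ?thesis
  proof (rule moduleI)
    show "abelian_group (FactModule M K)"
    proof (rule abelian_groupI)
      fix X assume "X \<in> carrier (FactModule M K)"
      then obtain x where x: "x \<in> carrier M" "X = K +>\<^bsub>M\<^esub> x" by auto
      then show "\<exists>Y\<in>carrier (FactModule M K). Y \<oplus>\<^bsub>FactModule M K\<^esub> X = \<zero>\<^bsub>FactModule M K\<^esub>"
        by (intro bexI[of _ "K +>\<^bsub>M\<^esub> (\<ominus>\<^bsub>M\<^esub> x)"]) (auto simp: M.l_neg)
    next
      fix X Y assume "X \<in> carrier (FactModule M K)" "Y \<in> carrier (FactModule M K)"
      then obtain x y where "x \<in> carrier M" "X = K +>\<^bsub>M\<^esub> x" "y \<in> carrier M" "Y = K +>\<^bsub>M\<^esub> y"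
        by auto
      then show "X \<oplus>\<^bsub>FactModule M K\<^esub> Y = Y \<oplus>\<^bsub>FactModule M K\<^esub> X"
        using M.a_comm[of x y] by simp
    qed (auto simp: M.a_assoc)
  qed (auto simp: R.cring_axioms smult_l_distr smult_r_distr smult_assoc1)
qed

lemma direct_sum_is_module:
  assumes M: "module R M" and N: "module R N"
  shows "module R (direct_sum M N)"
proof -
  interpret M: module R M by fact
  interpret N: module R N by fact
  show ?thesis
  proof (rule moduleI)
    show "abelian_group (direct_sum M N)"
    proof (rule abelian_groupI)
      fix x assume "x \<in> carrier (direct_sum M N)"
      then show "\<exists>y\<in>carrier (direct_sum M N). y \<oplus>\<^bsub>direct_sum M N\<^esub> x = \<zero>\<^bsub>direct_sum M N\<^esub>"
        by (intro bexI[of _ "(\<ominus>\<^bsub>M\<^esub> fst x, \<ominus>\<^bsub>N\<^esub> snd x)"])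
          (auto simp: direct_sum_def M.M.l_neg N.M.l_neg)
    qed (auto simp: direct_sum_def M.M.a_ac N.M.a_ac)
  qed (auto simp: direct_sum_def M.R.cring_axioms M.smult_l_distr M.smult_r_distr
      M.smult_assoc1 N.smult_l_distr N.smult_r_distr N.smult_assoc1)
qed

lemma zero_module_is_module: "cring R \<Longrightarrow> module R zero_module"
  by (rule moduleI) (auto intro!: abelian_groupI simp: zero_module_def)


section \<open>Uniformly S-torsion notions\<close>

locale multiplicative_subset = submonoid S R for S and R (structure) +
  assumes zero_notin: "\<zero> \<notin> S"

definition u_S_torsion :: "'r set \<Rightarrow> ('r, 'a, 'm) module_scheme \<Rightarrow> bool"
  where "u_S_torsion S U \<longleftrightarrow> (\<exists>s\<in>S. \<forall>x\<in>carrier U. s \<odot>\<^bsub>U\<^esub> x = \<zero>\<^bsub>U\<^esub>)"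

definition u_S_mono ::
  "('r, 'x) ring_scheme \<Rightarrow> 'r set \<Rightarrow> ('r, 'a, 'm) module_scheme \<Rightarrow> ('r, 'b, 'n) module_scheme \<Rightarrow>
   ('a \<Rightarrow> 'b) \<Rightarrow> bool"
  where "u_S_mono R S A B f \<longleftrightarrow>
    f \<in> module_hom R A B \<and> u_S_torsion S (A\<lparr>carrier := a_kernel A B f\<rparr>)"

definition u_S_epi ::
  "('r, 'x) ring_scheme \<Rightarrow> 'r set \<Rightarrow> ('r, 'a, 'm) module_scheme \<Rightarrow> ('r, 'b, 'n) module_scheme \<Rightarrow>
   ('a \<Rightarrow> 'b) \<Rightarrow> bool"
  where "u_S_epi R S A B f \<longleftrightarrow>
    f \<in> module_hom R A B \<and> u_S_torsion S (FactModule B (f ` carrier A))"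

definition u_S_iso ::
  "('r, 'x) ring_scheme \<Rightarrow> 'r set \<Rightarrow> ('r, 'a, 'm) module_scheme \<Rightarrow> ('r, 'b, 'n) module_scheme \<Rightarrow>
   ('a \<Rightarrow> 'b) \<Rightarrow> bool"
  where "u_S_iso R S A B f \<longleftrightarrow> u_S_mono R S A B f \<and> u_S_epi R S A B f"

definition u_S_exact ::
  "('r, 'x) ring_scheme \<Rightarrow> 'r set \<Rightarrow> ('r, 'a, 'm) module_scheme \<Rightarrow> ('r, 'b, 'n) module_scheme \<Rightarrow>
   ('r, 'c, 'p) module_scheme \<Rightarrow> ('a \<Rightarrow> 'b) \<Rightarrow> ('b \<Rightarrow> 'c) \<Rightarrow> bool"
  where "u_S_exact R S A B C f g \<longleftrightarrow>
    f \<in> module_hom R A B \<and> g \<in> module_hom R B C \<and>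
    (\<exists>s\<in>S. (\<forall>y\<in>a_kernel B C g. s \<odot>\<^bsub>B\<^esub> y \<in> f ` carrier A) \<and>
           (\<forall>y\<in>f ` carrier A. s \<odot>\<^bsub>B\<^esub> y \<in> a_kernel B C g))"

definition u_S_short_exact ::
  "('r, 'x) ring_scheme \<Rightarrow> 'r set \<Rightarrow> ('r, 'a, 'm) module_scheme \<Rightarrow> ('r, 'b, 'n) module_scheme \<Rightarrow>
   ('r, 'c, 'p) module_scheme \<Rightarrow> ('a \<Rightarrow> 'b) \<Rightarrow> ('b \<Rightarrow> 'c) \<Rightarrow> bool"
  where "u_S_short_exact R S A B C f g \<longleftrightarrow>
    u_S_exact R S zero_module A B (\<lambda>_. \<zero>\<^bsub>A\<^esub>) f \<and>
    u_S_exact R S A B C f g \<and>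
    u_S_exact R S B C zero_module g (\<lambda>_. ())"

definition u_S_split ::
  "('r, 'x) ring_scheme \<Rightarrow> 'r set \<Rightarrow> ('r, 'a, 'm) module_scheme \<Rightarrow> ('r, 'b, 'n) module_scheme \<Rightarrow>
   ('r, 'c, 'p) module_scheme \<Rightarrow> ('a \<Rightarrow> 'b) \<Rightarrow> ('b \<Rightarrow> 'c) \<Rightarrow> bool"
  where "u_S_split R S A B C f g \<longleftrightarrow>
    u_S_short_exact R S A B C f g \<and>
    (\<exists>s\<in>S. \<exists>f'\<in>module_hom R B A. \<forall>a\<in>carrier A. f' (f a) = s \<odot>\<^bsub>A\<^esub> a)"

definition u_S_split_epi ::
  "('r, 'x) ring_scheme \<Rightarrow> 'r set \<Rightarrow> ('r, 'a, 'm) module_scheme \<Rightarrow> ('r, 'b, 'n) module_scheme \<Rightarrow>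
   ('a \<Rightarrow> 'b) \<Rightarrow> bool"
  where "u_S_split_epi R S A B f \<longleftrightarrow>
    u_S_epi R S A B f \<and> u_S_split R S (A\<lparr>carrier := a_kernel A B f\<rparr>) A B (\<lambda>x. x) f"

text \<open>
  The natural map \<open>P \<rightarrow> P/K\<close> is \<open>\<lambda>x. K +>\<^bsub>P\<^esub> x\<close>. Note that \<open>s\<close> depends on \<open>K\<close> only, not on \<open>f\<close>.
\<close>

definition u_S_pseudo_projective ::
  "('r, 'x) ring_scheme \<Rightarrow> 'r set \<Rightarrow> ('r, 'a, 'm) module_scheme \<Rightarrow> bool"
  where "u_S_pseudo_projective R S P \<longleftrightarrow>
    (\<forall>K. submodule K R P \<longrightarrow>
      (\<exists>s\<in>S. \<forall>f. u_S_epi R S P (FactModule P K) f \<longrightarrow>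
        (\<exists>g\<in>module_hom R P P. \<forall>x\<in>carrier P. s \<odot>\<^bsub>FactModule P K\<^esub> f x = K +>\<^bsub>P\<^esub> g x)))"

end

theory Submission
  imports Defs
begin

text \<open>
  All four parts rest on one notion: \<open>P\<close> is a retract of \<open>Q\<close> up to \<open>S\<close> if there are homomorphisms
  \<open>g : Q \<rightarrow> P\<close> and \<open>g' : P \<rightarrow> Q\<close> whose composite \<open>g g'\<close> is multiplication by some \<open>t \<in> S\<close>.

  Pseudo-projectivity passes from \<open>Q\<close> to such a \<open>P\<close> (\<open>pseudo_projective_retract\<close>). For a submodule
  \<open>K\<close> of \<open>P\<close> put \<open>L = g\<^sup>-\<^sup>1(K)\<close>. Both maps descend to the quotients \<open>Q/L\<close> and \<open>P/K\<close>, and there both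
  composites are multiplication by \<open>t\<close>: on \<open>Q/L\<close> because \<open>g\<close> sends \<open>g'(g y) - t y\<close> to \<open>0 \<in> K\<close>. A
  \<open>u\<close>-\<open>S\<close>-epimorphism \<open>f : P \<rightarrow> P/K\<close> therefore yields the \<open>u\<close>-\<open>S\<close>-epimorphism \<open>g' f g : Q \<rightarrow> Q/L\<close>; if
  \<open>s\<close> times it lifts to \<open>h\<close>, then \<open>s t t f\<close> lifts to \<open>g h g'\<close>. Since \<open>L\<close> depends on \<open>K\<close> only, so does
  the factor \<open>s t t\<close>.

  It remains to find retracts. Direct summands and the left-hand module of a \<open>u\<close>-\<open>S\<close>-split sequence
  are retracts by definition; the others come from one construction (\<open>factor_up_to\<close>): a homomorphism that
  vanishes on the kernel of a map \<open>g\<close> with \<open>s C \<subseteq> Im g\<close> factors through \<open>g\<close> after multiplication by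
  \<open>s\<close>. It provides the section of a \<open>u\<close>-\<open>S\<close>-split sequence, the inverse up to \<open>S\<close> of a
  \<open>u\<close>-\<open>S\<close>-isomorphism, and the homomorphisms between quotient modules used above.

  For the last part it turns a \<open>u\<close>-\<open>S\<close>-epimorphism \<open>f : A \<rightarrow> A\<close> into a \<open>u\<close>-\<open>S\<close>-epimorphism
  \<open>\<phi> : A \<rightarrow> A/Ker f\<close> that inverts, up to \<open>t\<close>, the injection \<open>A/Ker f \<rightarrow> A\<close> induced by \<open>f\<close>. If \<open>s \<phi>\<close>
  lifts to \<open>h\<close>, then \<open>f h\<close> is multiplication by \<open>s t\<close>, and \<open>x \<mapsto> s t x - h (f x)\<close> retracts \<open>A\<close> onto
  \<open>Ker f\<close> up to \<open>s t\<close>.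
\<close>


section \<open>Homomorphisms and quotients of modules\<close>

lemma (in abelian_group) minus_zero_right: "x \<in> carrier G \<Longrightarrow> x \<ominus> \<zero> = x"
  using minus_equality[of \<zero> \<zero>] by (simp add: a_minus_def)

lemma (in abelian_group) minus_eq_zero_iff:
  assumes "x \<in> carrier G" "y \<in> carrier G"
  shows "x \<ominus> y = \<zero> \<longleftrightarrow> x = y"
  using assms minus_equality[of x "\<ominus> y"] by (auto simp: a_minus_def r_neg)

lemma module_homI:
  assumes "\<And>x. x \<in> carrier M \<Longrightarrow> f x \<in> carrier N"
    and "\<And>x y. x \<in> carrier M \<Longrightarrow> y \<in> carrier M \<Longrightarrow> f (x \<oplus>\<^bsub>M\<^esub> y) = f x \<oplus>\<^bsub>N\<^esub> f y"
    and "\<And>r x. r \<in> carrier R \<Longrightarrow> x \<in> carrier M \<Longrightarrow> f (r \<odot>\<^bsub>M\<^esub> x) = r \<odot>\<^bsub>N\<^esub> f x"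
  shows "f \<in> module_hom R M N"
  using assms by (auto simp: module_hom_def)

lemma module_hom_closed: "f \<in> module_hom R M N \<Longrightarrow> x \<in> carrier M \<Longrightarrow> f x \<in> carrier N"
  by (auto simp: module_hom_def)

lemma module_hom_add:
  "f \<in> module_hom R M N \<Longrightarrow> x \<in> carrier M \<Longrightarrow> y \<in> carrier M \<Longrightarrow> f (x \<oplus>\<^bsub>M\<^esub> y) = f x \<oplus>\<^bsub>N\<^esub> f y"
  by (auto simp: module_hom_def)

lemma module_hom_smult:
  "f \<in> module_hom R M N \<Longrightarrow> r \<in> carrier R \<Longrightarrow> x \<in> carrier M \<Longrightarrow> f (r \<odot>\<^bsub>M\<^esub> x) = r \<odot>\<^bsub>N\<^esub> f x"
  by (auto simp: module_hom_def)

lemma module_hom_abelian_group_hom: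
  assumes "module R M" "module R N" "f \<in> module_hom R M N"
  shows "abelian_group_hom M N f"
proof -
  interpret M: module R M by fact
  interpret N: module R N by fact
  show ?thesis
    using assms(3)
    by (intro abelian_group_homI group_hom.intro group_hom_axioms.intro M.M.a_group N.M.a_group
        M.abelian_group_axioms N.abelian_group_axioms) (auto simp: module_hom_def hom_def)
qed

lemma module_hom_zero:
  assumes "module R M" "module R N" "f \<in> module_hom R M N"
  shows "f \<zero>\<^bsub>M\<^esub> = \<zero>\<^bsub>N\<^esub>"
  by (rule abelian_group_hom.hom_zero[OF module_hom_abelian_group_hom[OF assms]])

lemma module_hom_minus:
  assumes "module R M" "module R N" "f \<in> module_hom R M N" "x \<in> carrier M" "y \<in> carrier M"
  shows "f (x \<ominus>\<^bsub>M\<^esub> y) = f x \<ominus>\<^bsub>N\<^esub> f y"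
proof -
  interpret M: module R M by fact
  interpret abelian_group_hom M N f by (rule module_hom_abelian_group_hom[OF assms(1-3)])
  show ?thesis using assms(4,5) by (simp add: a_minus_def)
qed

lemma module_hom_comp:
  assumes "f \<in> module_hom R M N" "g \<in> module_hom R N P"
  shows "(\<lambda>x. g (f x)) \<in> module_hom R M P"
  using assms by (intro module_homI) (simp_all add: module_hom_add module_hom_smult module_hom_closed)

lemma module_hom_diff:
  assumes "module R M" "module R N" "f \<in> module_hom R M N" "g \<in> module_hom R M N"
  shows "(\<lambda>x. f x \<ominus>\<^bsub>N\<^esub> g x) \<in> module_hom R M N"
proof -
  interpret N: module R N by fact
  show ?thesis
    using assms(3,4)
    by (intro module_homI)
      (simp_all add: module_hom_add module_hom_smult module_hom_closed a_minus_def
        N.smult_r_distr N.smult_r_minus N.M.minus_add N.M.a_ac)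
qed

lemma smult_module_hom:
  assumes "module R M" "r \<in> carrier R"
  shows "(\<lambda>x. r \<odot>\<^bsub>M\<^esub> x) \<in> module_hom R M M"
proof -
  interpret module R M by fact
  show ?thesis
    using assms(2)
    by (intro module_homI)
      (simp_all add: smult_r_distr smult_assoc1[symmetric] R.m_comm)
qed

text \<open>Closure under negation is multiplication by \<open>-1\<close>.\<close>

lemma submodule_if_smult_closed:
  assumes "module R M" "K \<subseteq> carrier M" "\<zero>\<^bsub>M\<^esub> \<in> K"
    and "\<And>x y. x \<in> K \<Longrightarrow> y \<in> K \<Longrightarrow> x \<oplus>\<^bsub>M\<^esub> y \<in> K"
    and "\<And>r x. r \<in> carrier R \<Longrightarrow> x \<in> K \<Longrightarrow> r \<odot>\<^bsub>M\<^esub> x \<in> K"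
  shows "submodule K R M"
proof -
  interpret module R M by fact
  have "\<ominus>\<^bsub>M\<^esub> x \<in> K" if "x \<in> K" for x
  proof -
    have "(\<ominus>\<^bsub>R\<^esub> \<one>\<^bsub>R\<^esub>) \<odot>\<^bsub>M\<^esub> x = \<ominus>\<^bsub>M\<^esub> x"
      using that assms(2) smult_l_minus[of "\<one>\<^bsub>R\<^esub>" x] by auto
    with assms(5)[of "\<ominus>\<^bsub>R\<^esub> \<one>\<^bsub>R\<^esub>" x] that show ?thesis by simp
  qed
  then show ?thesis
    using assms by (intro submoduleI) auto
qed

lemma submodule_preimage:
  assumes "module R M" "module R N" "f \<in> module_hom R M N" "submodule K R N"
  shows "submodule {x \<in> carrier M. f x \<in> K} R M"
proof -
  interpret M: module R M by fact
  interpret K: submodule K R N by fact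
  show ?thesis
    using assms(3) K.one_closed K.m_closed K.smult_closed
    by (intro submodule_if_smult_closed assms(1))
      (auto simp: module_hom_add module_hom_smult module_hom_zero[OF assms(1-3)])
qed

lemma submodule_kernel:
  assumes "module R M" "module R N" "f \<in> module_hom R M N"
  shows "submodule (a_kernel M N f) R M"
proof -
  interpret M: module R M by fact
  interpret N: module R N by fact
  show ?thesis
    using assms(3)
    by (intro submodule_if_smult_closed assms(1))
      (auto simp: a_kernel_def' module_hom_add module_hom_smult module_hom_zero[OF assms])
qed

lemma submodule_image:
  assumes "module R M" "module R N" "f \<in> module_hom R M N"
  shows "submodule (f ` carrier M) R N"
proof -
  interpret M: module R M by fact
  show ?thesis
    by (intro submodule_if_smult_closed assms(2))
      (use assms(3) in \<open>auto simp: module_hom_add[symmetric] module_hom_smult[symmetric]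
        module_hom_zero[OF assms, symmetric] module_hom_closed\<close>)
qed

lemma coset_eq_iff_diff_mem:
  assumes "module R M" "submodule K R M" "x \<in> carrier M" "y \<in> carrier M"
  shows "K +>\<^bsub>M\<^esub> x = K +>\<^bsub>M\<^esub> y \<longleftrightarrow> x \<ominus>\<^bsub>M\<^esub> y \<in> K"
proof -
  interpret module R M by fact
  interpret K: abelian_subgroup K M by (rule submodule_abelian_subgroup[OF assms(1,2)])
  show ?thesis
    using assms(3,4) K.a_rcos_module M.a_repr_independence[OF _ _ K.a_subgroup] K.a_rcos_self
    by (metis K.a_rcos_module_rev K.a_rcos_module_imp a_minus_def)
qed

lemma natural_module_hom:
  assumes "module R M" "submodule K R M"
  shows "(\<lambda>x. K +>\<^bsub>M\<^esub> x) \<in> module_hom R M (FactModule M K)"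
  by (rule module_homI)
    (simp_all add: add_FactModule[OF assms] smult_FactModule[OF assms] carrier_FactModule)

lemma zero_FactModule: "\<zero>\<^bsub>FactModule M K\<^esub> = K"
  by (simp add: FactModule_def)

lemma coset_eq_self_iff:
  assumes "module R M" "submodule K R M" "x \<in> carrier M"
  shows "K +>\<^bsub>M\<^esub> x = K \<longleftrightarrow> x \<in> K"
proof -
  interpret module R M by fact
  interpret K: abelian_subgroup K M by (rule submodule_abelian_subgroup[OF assms(1,2)])
  show ?thesis
    using coset_eq_iff_diff_mem[OF assms M.zero_closed] M.a_coset_add_zero[OF K.a_subset] assms(3)
    by (simp add: M.minus_zero_right)
qed

text \<open>
  The preimage under \<open>g\<close> of \<open>s c\<close> is unique up to the kernel of \<open>g\<close>, where \<open>h\<close> vanishes, so that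
  \<open>h'\<close> is well defined. With \<open>s = 1\<close> this is the usual factorization through a surjection.
\<close>

lemma factor_up_to:
  assumes B: "module R B" and C: "module R C" and D: "module R D" and s: "s \<in> carrier R"
    and g: "g \<in> module_hom R B C" and h: "h \<in> module_hom R B D"
    and surj: "\<And>c. c \<in> carrier C \<Longrightarrow> \<exists>b\<in>carrier B. g b = s \<odot>\<^bsub>C\<^esub> c"
    and ker: "\<And>b. b \<in> carrier B \<Longrightarrow> g b = \<zero>\<^bsub>C\<^esub> \<Longrightarrow> h b = \<zero>\<^bsub>D\<^esub>"
  obtains h' where "h' \<in> module_hom R C D"
    and "\<And>b c. \<lbrakk>b \<in> carrier B; c \<in> carrier C; g b = s \<odot>\<^bsub>C\<^esub> c\<rbrakk> \<Longrightarrow> h' c = h b"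
proof -
  interpret B: module R B by fact
  interpret C: module R C by fact
  interpret D: module R D by fact
  obtain p where p: "\<And>c. c \<in> carrier C \<Longrightarrow> p c \<in> carrier B \<and> g (p c) = s \<odot>\<^bsub>C\<^esub> c"
    using surj by metis
  have eq: "h (p c) = h b" if b: "b \<in> carrier B" and c: "c \<in> carrier C" and "g b = s \<odot>\<^bsub>C\<^esub> c" for b c
  proof -
    have pc: "p c \<in> carrier B" and gpc: "g (p c) = g b" using p[OF c] that by auto
    have "g (p c \<ominus>\<^bsub>B\<^esub> b) = \<zero>\<^bsub>C\<^esub>"
      using b pc gpc
      by (simp add: module_hom_minus[OF B C g] module_hom_closed[OF g] C.M.minus_eq_zero_iff)
    then have "h (p c) \<ominus>\<^bsub>D\<^esub> h b = \<zero>\<^bsub>D\<^esub>"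
      using ker[of "p c \<ominus>\<^bsub>B\<^esub> b"] b pc by (simp add: module_hom_minus[OF B D h])
    then show ?thesis
      using b pc by (simp add: D.M.minus_eq_zero_iff module_hom_closed[OF h])
  qed
  show thesis
  proof (rule that)
    show "(\<lambda>c. h (p c)) \<in> module_hom R C D"
    proof (rule module_homI)
      show "h (p c) \<in> carrier D" if "c \<in> carrier C" for c
        using p[OF that] by (simp add: module_hom_closed[OF h])
    next
      fix c d assume c: "c \<in> carrier C" and d: "d \<in> carrier C"
      have "g (p c \<oplus>\<^bsub>B\<^esub> p d) = s \<odot>\<^bsub>C\<^esub> (c \<oplus>\<^bsub>C\<^esub> d)"
        using p c d s by (simp add: module_hom_add[OF g] C.smult_r_distr)
      then show "h (p (c \<oplus>\<^bsub>C\<^esub> d)) = h (p c) \<oplus>\<^bsub>D\<^esub> h (p d)"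
        using eq[of "p c \<oplus>\<^bsub>B\<^esub> p d" "c \<oplus>\<^bsub>C\<^esub> d"] p c d by (simp add: module_hom_add[OF h])
    next
      fix r c assume r: "r \<in> carrier R" and c: "c \<in> carrier C"
      have "g (r \<odot>\<^bsub>B\<^esub> p c) = s \<odot>\<^bsub>C\<^esub> (r \<odot>\<^bsub>C\<^esub> c)"
        using p r c s by (simp add: module_hom_smult[OF g] C.smult_assoc1[symmetric] B.R.m_comm)
      then show "h (p (r \<odot>\<^bsub>C\<^esub> c)) = r \<odot>\<^bsub>D\<^esub> h (p c)"
        using eq[of "r \<odot>\<^bsub>B\<^esub> p c" "r \<odot>\<^bsub>C\<^esub> c"] p r c by (simp add: module_hom_smult[OF h])
    qed
  qed (rule eq)
qed

lemma module_hom_FactModule: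
  assumes M: "module R M" and N: "module R N" and g: "g \<in> module_hom R M N"
    and K: "submodule K R M" and L: "submodule L R N" and KL: "\<And>x. x \<in> K \<Longrightarrow> g x \<in> L"
  obtains g' where "g' \<in> module_hom R (FactModule M K) (FactModule N L)"
    and "\<And>x. x \<in> carrier M \<Longrightarrow> g' (K +>\<^bsub>M\<^esub> x) = L +>\<^bsub>N\<^esub> g x"
proof -
  interpret M: module R M by fact
  interpret MK: module R "FactModule M K" by (rule FactModule_is_module[OF M K])
  have gc: "g x \<in> carrier N" if "x \<in> carrier M" for x using module_hom_closed[OF g that] .
  have surj: "\<exists>x\<in>carrier M. K +>\<^bsub>M\<^esub> x = \<one>\<^bsub>R\<^esub> \<odot>\<^bsub>FactModule M K\<^esub> X"
    if "X \<in> carrier (FactModule M K)" for X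
    using that MK.smult_one[OF that] by (auto simp: carrier_FactModule)
  have ker: "L +>\<^bsub>N\<^esub> g x = \<zero>\<^bsub>FactModule N L\<^esub>"
    if "x \<in> carrier M" "K +>\<^bsub>M\<^esub> x = \<zero>\<^bsub>FactModule M K\<^esub>" for x
    using that KL by (simp add: zero_FactModule coset_eq_self_iff[OF M K] coset_eq_self_iff[OF N L] gc)
  obtain g' where g': "g' \<in> module_hom R (FactModule M K) (FactModule N L)"
    and eq: "\<And>x X. \<lbrakk>x \<in> carrier M; X \<in> carrier (FactModule M K);
        K +>\<^bsub>M\<^esub> x = \<one>\<^bsub>R\<^esub> \<odot>\<^bsub>FactModule M K\<^esub> X\<rbrakk> \<Longrightarrow> g' X = L +>\<^bsub>N\<^esub> g x"
    by (rule factor_up_to[OF M FactModule_is_module[OF M K] FactModule_is_module[OF N L]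
        M.R.one_closed natural_module_hom[OF M K]
        module_hom_comp[OF g natural_module_hom[OF N L]] surj ker]) blast+
  show thesis
  proof (rule that[OF g'])
    fix x assume x: "x \<in> carrier M"
    then have "K +>\<^bsub>M\<^esub> x \<in> carrier (FactModule M K)" by (simp add: carrier_FactModule)
    from eq[OF x this] MK.smult_one[OF this] show "g' (K +>\<^bsub>M\<^esub> x) = L +>\<^bsub>N\<^esub> g x" by simp
  qed
qed


section \<open>Epimorphisms up to a multiplicative subset\<close>

context multiplicative_subset
begin

lemma u_S_epi_iff:
  assumes A: "module R A" and B: "module R B"
  shows "u_S_epi R S A B f \<longleftrightarrow> f \<in> module_hom R A B \<and>
    (\<exists>s\<in>S. \<forall>y\<in>carrier B. \<exists>x\<in>carrier A. f x = s \<odot>\<^bsub>B\<^esub> y)"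
proof (cases "f \<in> module_hom R A B")
  case True
  interpret B: module R B by fact
  note I = submodule_image[OF A B True]
  have "s \<odot>\<^bsub>FactModule B (f ` carrier A)\<^esub> (f ` carrier A +>\<^bsub>B\<^esub> y) = \<zero>\<^bsub>FactModule B (f ` carrier A)\<^esub>
      \<longleftrightarrow> (\<exists>x\<in>carrier A. f x = s \<odot>\<^bsub>B\<^esub> y)" if "s \<in> S" "y \<in> carrier B" for s y
  proof -
    have s: "s \<in> carrier R" using that subset by auto
    show ?thesis
      unfolding smult_FactModule[OF B I s that(2)] zero_FactModule
        coset_eq_self_iff[OF B I B.smult_closed[OF s that(2)]] by force
  qed
  with True show ?thesis
    by (simp add: u_S_epi_def u_S_torsion_def carrier_FactModule cong: bex_cong ball_cong)
qed (simp add: u_S_epi_def)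

lemma u_S_epi_comp:
  assumes A: "module R A" and B: "module R B" and C: "module R C"
    and f: "u_S_epi R S A B f" and g: "u_S_epi R S B C g"
  shows "u_S_epi R S A C (\<lambda>x. g (f x))"
proof -
  interpret C: module R C by fact
  from f obtain s where fh: "f \<in> module_hom R A B" and s: "s \<in> S"
    and fs: "\<And>y. y \<in> carrier B \<Longrightarrow> \<exists>x\<in>carrier A. f x = s \<odot>\<^bsub>B\<^esub> y"
    unfolding u_S_epi_iff[OF A B] by blast
  from g obtain t where gh: "g \<in> module_hom R B C" and t: "t \<in> S"
    and gt: "\<And>z. z \<in> carrier C \<Longrightarrow> \<exists>y\<in>carrier B. g y = t \<odot>\<^bsub>C\<^esub> z"
    unfolding u_S_epi_iff[OF B C] by blast
  have sR: "s \<in> carrier R" and tR: "t \<in> carrier R" using s t subset by auto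
  have "\<exists>x\<in>carrier A. g (f x) = (s \<otimes> t) \<odot>\<^bsub>C\<^esub> z" if z: "z \<in> carrier C" for z
  proof -
    obtain y where y: "y \<in> carrier B" "g y = t \<odot>\<^bsub>C\<^esub> z" using gt[OF z] by blast
    obtain x where x: "x \<in> carrier A" "f x = s \<odot>\<^bsub>B\<^esub> y" using fs[OF y(1)] by blast
    have "g (f x) = (s \<otimes> t) \<odot>\<^bsub>C\<^esub> z"
      using x y z sR tR by (simp add: module_hom_smult[OF gh] C.smult_assoc1)
    with x(1) show ?thesis by blast
  qed
  with m_closed[OF s t] module_hom_comp[OF fh gh] show ?thesis
    unfolding u_S_epi_iff[OF A C] by blast
qed


section \<open>Retracts up to a multiplicative subset\<close>

definition retract_up_to :: "('a, 'c, 'm) module_scheme \<Rightarrow> ('a, 'd, 'n) module_scheme \<Rightarrow> bool"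
  where "retract_up_to P Q \<longleftrightarrow> (\<exists>t\<in>S. \<exists>g\<in>module_hom R Q P. \<exists>g'\<in>module_hom R P Q.
    \<forall>x\<in>carrier P. g (g' x) = t \<odot>\<^bsub>P\<^esub> x)"

lemma retract_up_toI:
  assumes "t \<in> S" "g \<in> module_hom R Q P" "g' \<in> module_hom R P Q"
    and "\<And>x. x \<in> carrier P \<Longrightarrow> g (g' x) = t \<odot>\<^bsub>P\<^esub> x"
  shows "retract_up_to P Q"
  unfolding retract_up_to_def
  by (intro bexI[OF _ assms(1)] bexI[OF _ assms(2)] bexI[OF _ assms(3)] ballI assms(4))

text \<open>
  The submodule \<open>L = g\<^sup>-\<^sup>1(K)\<close> is what makes the maps induced by \<open>g\<close> and \<open>g'\<close> mutually inverse up to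
  \<open>t\<close>, although \<open>g' g\<close> need not be multiplication by \<open>t\<close> on \<open>Q\<close> itself.
\<close>

theorem pseudo_projective_retract:
  assumes P: "module R P" and Q: "module R Q" and retr: "retract_up_to P Q"
    and pp: "u_S_pseudo_projective R S Q"
  shows "u_S_pseudo_projective R S P"
  unfolding u_S_pseudo_projective_def
proof (intro allI impI)
  fix K assume K: "submodule K R P"
  from retr obtain t g g' where t: "t \<in> S" and g: "g \<in> module_hom R Q P"
    and g': "g' \<in> module_hom R P Q" and gg': "\<And>x. x \<in> carrier P \<Longrightarrow> g (g' x) = t \<odot>\<^bsub>P\<^esub> x"
    unfolding retract_up_to_def by blast
  interpret P: module R P by fact
  interpret Q: module R Q by fact
  have tR: "t \<in> carrier R" using t subset by auto
  define L where "L = {y \<in> carrier Q. g y \<in> K}"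
  have L: "submodule L R Q" unfolding L_def by (rule submodule_preimage[OF Q P g K])
  interpret K: submodule K R P by fact
  let ?PK = "FactModule P K" and ?QL = "FactModule Q L"
  have PK: "module R ?PK" and QL: "module R ?QL"
    by (rule FactModule_is_module[OF P K] FactModule_is_module[OF Q L])+
  interpret PK: module R ?PK by (rule PK)
  note gc = module_hom_closed[OF g] and g'c = module_hom_closed[OF g']
  obtain gq where gq: "gq \<in> module_hom R ?QL ?PK"
    and gq_eq: "\<And>y. y \<in> carrier Q \<Longrightarrow> gq (L +>\<^bsub>Q\<^esub> y) = K +>\<^bsub>P\<^esub> g y"
    by (rule module_hom_FactModule[OF Q P g L K]) (auto simp: L_def)
  have g'KL: "g' x \<in> L" if "x \<in> K" for x
    using that K.subset gg' g'c tR K.smult_closed by (auto simp: L_def)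
  obtain gq' where gq': "gq' \<in> module_hom R ?PK ?QL"
    and gq'_eq: "\<And>x. x \<in> carrier P \<Longrightarrow> gq' (K +>\<^bsub>P\<^esub> x) = L +>\<^bsub>Q\<^esub> g' x"
    by (rule module_hom_FactModule[OF P Q g' K L g'KL]) auto
  have gqgq': "gq (gq' X) = t \<odot>\<^bsub>?PK\<^esub> X" if "X \<in> carrier ?PK" for X
    using that by (auto simp: carrier_FactModule gq'_eq gq_eq g'c gg' smult_FactModule[OF P K tR])
  have g_epi: "u_S_epi R S Q P g"
    unfolding u_S_epi_iff[OF Q P] using g t gg' g'c by blast
  \<comment> \<open>The coset of \<open>g y\<close> is the required preimage, since \<open>g'(g y) - t y\<close> lies in \<open>L\<close>.\<close>
  have "\<exists>X\<in>carrier ?PK. gq' X = t \<odot>\<^bsub>?QL\<^esub> Y" if "Y \<in> carrier ?QL" for Y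
  proof -
    from that obtain y where y: "y \<in> carrier Q" and Y: "Y = L +>\<^bsub>Q\<^esub> y"
      by (auto simp: carrier_FactModule)
    have "g (g' (g y) \<ominus>\<^bsub>Q\<^esub> t \<odot>\<^bsub>Q\<^esub> y) = \<zero>\<^bsub>P\<^esub>"
      using y tR by (simp add: module_hom_minus[OF Q P g] gc g'c gg' module_hom_smult[OF g]
          P.M.minus_eq_zero_iff)
    then have "g' (g y) \<ominus>\<^bsub>Q\<^esub> t \<odot>\<^bsub>Q\<^esub> y \<in> L"
      using y tR K.one_closed by (simp add: L_def gc g'c)
    then have "gq' (K +>\<^bsub>P\<^esub> g y) = t \<odot>\<^bsub>?QL\<^esub> Y"
      using y tR by (simp add: Y gq'_eq gc g'c smult_FactModule[OF Q L tR] coset_eq_iff_diff_mem[OF Q L])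
    with y show ?thesis by (auto simp: carrier_FactModule gc)
  qed
  with gq' t have gq'_epi: "u_S_epi R S ?PK ?QL gq'"
    unfolding u_S_epi_iff[OF PK QL] by blast
  from pp L obtain s where s: "s \<in> S"
    and lift: "\<And>F. u_S_epi R S Q ?QL F \<Longrightarrow>
      \<exists>h\<in>module_hom R Q Q. \<forall>y\<in>carrier Q. s \<odot>\<^bsub>?QL\<^esub> F y = L +>\<^bsub>Q\<^esub> h y"
    unfolding u_S_pseudo_projective_def by blast
  have sR: "s \<in> carrier R" using s subset by auto
  show "\<exists>s\<in>S. \<forall>f. u_S_epi R S P ?PK f \<longrightarrow>
      (\<exists>h\<in>module_hom R P P. \<forall>x\<in>carrier P. s \<odot>\<^bsub>?PK\<^esub> f x = K +>\<^bsub>P\<^esub> h x)"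
  proof (rule bexI[of _ "s \<otimes> t \<otimes> t"], intro allI impI)
    show "s \<otimes> t \<otimes> t \<in> S" using s t m_closed by blast
  next
    fix f assume f_epi: "u_S_epi R S P ?PK f"
    then have f: "f \<in> module_hom R P ?PK" by (simp add: u_S_epi_def)
    note fc = module_hom_closed[OF f]
    have "u_S_epi R S Q ?QL (\<lambda>y. gq' (f (g y)))"
      by (rule u_S_epi_comp[OF Q PK QL u_S_epi_comp[OF Q P PK g_epi f_epi] gq'_epi])
    from lift[OF this] obtain h where h: "h \<in> module_hom R Q Q"
      and hl: "\<And>y. y \<in> carrier Q \<Longrightarrow> s \<odot>\<^bsub>?QL\<^esub> gq' (f (g y)) = L +>\<^bsub>Q\<^esub> h y" by blast
    have "(s \<otimes> t \<otimes> t) \<odot>\<^bsub>?PK\<^esub> f x = K +>\<^bsub>P\<^esub> g (h (g' x))" if x: "x \<in> carrier P" for x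
    proof -
      have "K +>\<^bsub>P\<^esub> g (h (g' x)) = gq (s \<odot>\<^bsub>?QL\<^esub> gq' (f (t \<odot>\<^bsub>P\<^esub> x)))"
        using x gq_eq[of "h (g' x)"] hl[of "g' x"] by (simp add: g'c gg' module_hom_closed[OF h])
      also have "\<dots> = s \<odot>\<^bsub>?PK\<^esub> (t \<odot>\<^bsub>?PK\<^esub> (t \<odot>\<^bsub>?PK\<^esub> f x))"
        using x sR tR by (simp add: module_hom_smult[OF gq] module_hom_closed[OF gq'] fc gqgq'
            module_hom_smult[OF f])
      also have "\<dots> = (s \<otimes> t \<otimes> t) \<odot>\<^bsub>?PK\<^esub> f x"
        using x sR tR by (simp add: fc PK.smult_assoc1)
      finally show ?thesis ..
    qed
    then show "\<exists>h\<in>module_hom R P P. \<forall>x\<in>carrier P. (s \<otimes> t \<otimes> t) \<odot>\<^bsub>?PK\<^esub> f x = K +>\<^bsub>P\<^esub> h x"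
      by (intro bexI[OF _ module_hom_comp[OF module_hom_comp[OF g' h] g]] ballI)
  qed
qed


section \<open>Sources of retracts\<close>

lemma retract_up_to_split_left:
  assumes "u_S_split R S A B C f g"
  shows "retract_up_to A B"
proof -
  have "u_S_exact R S A B C f g"
    using assms by (simp add: u_S_split_def u_S_short_exact_def)
  then have "f \<in> module_hom R A B" by (simp add: u_S_exact_def)
  with assms show ?thesis
    by (auto simp: u_S_split_def intro: retract_up_toI)
qed

text \<open>
  The endomorphism \<open>s - f f'\<close> of \<open>B\<close> vanishes on the image of \<open>f\<close>. Multiplied by the factor \<open>r\<close> that
  carries the kernel of \<open>g\<close> into that image, it vanishes on the kernel of \<open>g\<close> and hence factors
  through \<open>g\<close> up to \<open>S\<close>. The factorization is a section up to \<open>S\<close>, because \<open>g\<close> kills \<open>r f f'\<close> and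
  only the multiple of the identity survives.
\<close>

lemma retract_up_to_split_right:
  assumes A: "module R A" and B: "module R B" and C: "module R C"
    and split: "u_S_split R S A B C f g"
  shows "retract_up_to C B"
proof -
  interpret A: module R A by fact
  interpret B: module R B by fact
  interpret C: module R C by fact
  have exact_B: "u_S_exact R S A B C f g" and exact_C: "u_S_exact R S B C zero_module g (\<lambda>_. ())"
    using split by (simp_all add: u_S_split_def u_S_short_exact_def)
  from exact_B obtain r where f: "f \<in> module_hom R A B" and g: "g \<in> module_hom R B C" and r: "r \<in> S"
    and ker_im: "\<forall>y\<in>a_kernel B C g. r \<odot>\<^bsub>B\<^esub> y \<in> f ` carrier A"
    and im_ker: "\<forall>y\<in>f ` carrier A. r \<odot>\<^bsub>B\<^esub> y \<in> a_kernel B C g"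
    unfolding u_S_exact_def by blast
  have kf: "r \<odot>\<^bsub>B\<^esub> y \<in> f ` carrier A" if "y \<in> carrier B" "g y = \<zero>\<^bsub>C\<^esub>" for y
    using that ker_im by (simp add: a_kernel_def')
  have fk: "g (r \<odot>\<^bsub>B\<^esub> f x) = \<zero>\<^bsub>C\<^esub>" if "x \<in> carrier A" for x
    using that im_ker by (simp add: a_kernel_def')
  from exact_C have "\<exists>t\<in>S. \<forall>c\<in>carrier C. t \<odot>\<^bsub>C\<^esub> c \<in> g ` carrier B"
    by (auto simp: u_S_exact_def a_kernel_def' zero_module_def)
  then obtain t where t: "t \<in> S" and "\<forall>c\<in>carrier C. t \<odot>\<^bsub>C\<^esub> c \<in> g ` carrier B"
    by blast
  then have gt: "\<exists>b\<in>carrier B. g b = t \<odot>\<^bsub>C\<^esub> c" if "c \<in> carrier C" for c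
    using that by force
  from split obtain s f' where s: "s \<in> S" and f': "f' \<in> module_hom R B A"
    and f'f: "\<forall>x\<in>carrier A. f' (f x) = s \<odot>\<^bsub>A\<^esub> x"
    unfolding u_S_split_def by blast
  have R: "r \<in> carrier R" "s \<in> carrier R" "t \<in> carrier R" using r s t subset by auto
  note [simp] = R module_hom_closed[OF f] module_hom_closed[OF g] module_hom_closed[OF f']
  define h where "h b = s \<odot>\<^bsub>B\<^esub> (r \<odot>\<^bsub>B\<^esub> b) \<ominus>\<^bsub>B\<^esub> f (f' (r \<odot>\<^bsub>B\<^esub> b))" for b
  have h: "h \<in> module_hom R B B"
    unfolding h_def
    by (rule module_hom_diff[OF B B
          module_hom_comp[OF smult_module_hom[OF B R(1)] smult_module_hom[OF B R(2)]]
          module_hom_comp[OF smult_module_hom[OF B R(1)] module_hom_comp[OF f' f]]])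
  have "h b = \<zero>\<^bsub>B\<^esub>" if b: "b \<in> carrier B" and gb: "g b = \<zero>\<^bsub>C\<^esub>" for b
  proof -
    obtain a where a: "a \<in> carrier A" "r \<odot>\<^bsub>B\<^esub> b = f a" using kf[OF b gb] by blast
    then show ?thesis
      by (simp add: h_def f'f module_hom_smult[OF f] B.M.minus_eq_zero_iff)
  qed
  from factor_up_to[OF B C B R(3) g h gt this] obtain g' where g': "g' \<in> module_hom R C B"
    and g'_eq: "\<And>b c. \<lbrakk>b \<in> carrier B; c \<in> carrier C; g b = t \<odot>\<^bsub>C\<^esub> c\<rbrakk> \<Longrightarrow> g' c = h b"
    by blast
  have "g (g' c) = (s \<otimes> r \<otimes> t) \<odot>\<^bsub>C\<^esub> c" if c: "c \<in> carrier C" for c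
  proof -
    obtain b where b: "b \<in> carrier B" "g b = t \<odot>\<^bsub>C\<^esub> c" using gt[OF c] by blast
    have "g (f (f' (r \<odot>\<^bsub>B\<^esub> b))) = g (r \<odot>\<^bsub>B\<^esub> f (f' b))"
      using b(1) by (simp add: module_hom_smult[OF f'] module_hom_smult[OF f])
    then have "g (h b) = s \<odot>\<^bsub>C\<^esub> (r \<odot>\<^bsub>C\<^esub> (t \<odot>\<^bsub>C\<^esub> c))"
      using b c fk by (simp add: h_def module_hom_minus[OF B C g] module_hom_smult[OF g]
          C.M.minus_zero_right)
    then show ?thesis
      using c g'_eq[OF b(1) c b(2)] by (simp add: C.smult_assoc1)
  qed
  then show ?thesis
    by (rule retract_up_toI[OF m_closed[OF m_closed[OF s r] t] g g'])
qed

lemma retract_up_to_direct_sum: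
  assumes A: "module R A" and B: "module R B"
  shows "retract_up_to A (direct_sum A B)" "retract_up_to B (direct_sum A B)"
proof -
  interpret A: module R A by fact
  interpret B: module R B by fact
  have "fst \<in> module_hom R (direct_sum A B) A" "(\<lambda>x. (x, \<zero>\<^bsub>B\<^esub>)) \<in> module_hom R A (direct_sum A B)"
    by (auto intro!: module_homI simp: direct_sum_def)
  then show "retract_up_to A (direct_sum A B)"
    by (rule retract_up_toI[OF one_closed]) simp
  have "snd \<in> module_hom R (direct_sum A B) B" "(\<lambda>y. (\<zero>\<^bsub>A\<^esub>, y)) \<in> module_hom R B (direct_sum A B)"
    by (auto intro!: module_homI simp: direct_sum_def)
  then show "retract_up_to B (direct_sum A B)"
    by (rule retract_up_toI[OF one_closed]) simp
qed

text \<open>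
  Multiplication by an annihilator \<open>s\<close> of the kernel of \<open>f\<close> factors through \<open>f\<close> up to \<open>S\<close>; the
  factorization inverts \<open>f\<close> up to \<open>S\<close> on both sides.
\<close>

lemma retract_up_to_iso:
  assumes A: "module R A" and B: "module R B" and iso: "u_S_iso R S A B f"
  shows "retract_up_to A B" "retract_up_to B A"
proof -
  interpret A: module R A by fact
  interpret B: module R B by fact
  from iso obtain s where f: "f \<in> module_hom R A B" and s: "s \<in> S"
    and ker: "\<And>x. x \<in> carrier A \<Longrightarrow> f x = \<zero>\<^bsub>B\<^esub> \<Longrightarrow> s \<odot>\<^bsub>A\<^esub> x = \<zero>\<^bsub>A\<^esub>"
    unfolding u_S_iso_def u_S_mono_def u_S_torsion_def a_kernel_def' by auto
  from iso obtain t where t: "t \<in> S"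
    and ft: "\<And>y. y \<in> carrier B \<Longrightarrow> \<exists>x\<in>carrier A. f x = t \<odot>\<^bsub>B\<^esub> y"
    unfolding u_S_iso_def u_S_epi_iff[OF A B] by blast
  have R: "s \<in> carrier R" "t \<in> carrier R" using s t subset by auto
  from factor_up_to[OF A B A R(2) f smult_module_hom[OF A R(1)] ft ker] obtain f'
    where f': "f' \<in> module_hom R B A"
      and f'_eq: "\<And>x y. \<lbrakk>x \<in> carrier A; y \<in> carrier B; f x = t \<odot>\<^bsub>B\<^esub> y\<rbrakk> \<Longrightarrow> f' y = s \<odot>\<^bsub>A\<^esub> x"
    by blast
  have st: "s \<otimes> t \<in> S" using m_closed[OF s t] .
  have "f' (f x) = (s \<otimes> t) \<odot>\<^bsub>A\<^esub> x" if "x \<in> carrier A" for x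
    using that R f'_eq[of "t \<odot>\<^bsub>A\<^esub> x" "f x"]
    by (simp add: module_hom_smult[OF f] module_hom_closed[OF f] A.smult_assoc1)
  then show "retract_up_to A B" by (rule retract_up_toI[OF st f' f])
  have "f (f' y) = (s \<otimes> t) \<odot>\<^bsub>B\<^esub> y" if y: "y \<in> carrier B" for y
  proof -
    obtain x where "x \<in> carrier A" "f x = t \<odot>\<^bsub>B\<^esub> y" using ft[OF y] by blast
    with y R f'_eq show ?thesis by (simp add: module_hom_smult[OF f] B.smult_assoc1)
  qed
  then show "retract_up_to B A" by (rule retract_up_toI[OF st f f'])
qed


section \<open>Splitting of epimorphisms\<close>

lemma u_S_short_exact_kernel:
  assumes A: "module R A" and B: "module R B" and epi: "u_S_epi R S A B f"
  shows "u_S_short_exact R S (A\<lparr>carrier := a_kernel A B f\<rparr>) A B (\<lambda>x. x) f"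
proof -
  interpret A: module R A by fact
  interpret B: module R B by fact
  from epi obtain t where f: "f \<in> module_hom R A B" and t: "t \<in> S"
    and ft: "\<And>y. y \<in> carrier B \<Longrightarrow> \<exists>x\<in>carrier A. f x = t \<odot>\<^bsub>B\<^esub> y"
    unfolding u_S_epi_iff[OF A B] by blast
  have fz: "f \<zero>\<^bsub>A\<^esub> = \<zero>\<^bsub>B\<^esub>" by (rule module_hom_zero[OF A B f])
  have "u_S_exact R S zero_module (A\<lparr>carrier := a_kernel A B f\<rparr>) A
      (\<lambda>_. \<zero>\<^bsub>A\<lparr>carrier := a_kernel A B f\<rparr>\<^esub>) (\<lambda>x. x)"
    unfolding u_S_exact_def
    using one_closed fz
    by (auto intro!: module_homI bexI[of _ "\<one>"] intro: exI[of _ "\<one>"]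
        simp: zero_module_def a_kernel_def')
  moreover have "u_S_exact R S (A\<lparr>carrier := a_kernel A B f\<rparr>) A B (\<lambda>x. x) f"
    unfolding u_S_exact_def
    using one_closed f by (auto intro!: module_homI bexI[of _ "\<one>"] simp: a_kernel_def')
  moreover have "u_S_exact R S A B zero_module f (\<lambda>_. ())"
    unfolding u_S_exact_def
  proof (intro conjI bexI ballI)
    show "(\<lambda>_. ()) \<in> module_hom R B zero_module"
      by (rule module_homI) (simp_all add: zero_module_def)
    show "t \<odot>\<^bsub>B\<^esub> y \<in> f ` carrier A" if "y \<in> a_kernel B zero_module (\<lambda>_. ())" for y
      using that ft[of y] by (force simp: a_kernel_def' zero_module_def)
    show "t \<odot>\<^bsub>B\<^esub> y \<in> a_kernel B zero_module (\<lambda>_. ())" if "y \<in> f ` carrier A" for y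
      using that t subset module_hom_closed[OF f] by (auto simp: a_kernel_def' zero_module_def)
  qed (use f t in simp_all)
  ultimately show ?thesis unfolding u_S_short_exact_def by blast
qed

text \<open>
  The lift \<open>h\<close> of \<open>s \<phi>\<close> is a section of \<open>f\<close> up to \<open>s t\<close>, because \<open>h y\<close> and \<open>s\<close> times a preimage of
  \<open>t y\<close> lie in the same coset of \<open>Ker f\<close>. The complementary map \<open>x \<mapsto> s t x - h (f x)\<close> then takes
  values in \<open>Ker f\<close>, and on \<open>Ker f\<close> its second term vanishes.
\<close>

theorem pseudo_projective_epi_splits:
  assumes A: "module R A" and pp: "u_S_pseudo_projective R S A" and epi: "u_S_epi R S A A f"
  shows "u_S_split_epi R S A A f"
proof -
  interpret A: module R A by fact
  from epi obtain t where f: "f \<in> module_hom R A A" and t: "t \<in> S"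
    and ft: "\<And>y. y \<in> carrier A \<Longrightarrow> \<exists>x\<in>carrier A. f x = t \<odot>\<^bsub>A\<^esub> y"
    unfolding u_S_epi_iff[OF A A] by blast
  define K where "K = a_kernel A A f"
  have K: "submodule K R A" unfolding K_def by (rule submodule_kernel[OF A A f])
  have in_K: "x \<in> K \<longleftrightarrow> x \<in> carrier A \<and> f x = \<zero>\<^bsub>A\<^esub>" for x
    by (auto simp: K_def a_kernel_def')
  have AK: "module R (FactModule A K)" by (rule FactModule_is_module[OF A K])
  note fc = module_hom_closed[OF f]
  have tR: "t \<in> carrier R" using t subset by auto
  have ker: "K +>\<^bsub>A\<^esub> x = \<zero>\<^bsub>FactModule A K\<^esub>" if "x \<in> carrier A" "f x = \<zero>\<^bsub>A\<^esub>" for x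
    using that by (simp add: zero_FactModule coset_eq_self_iff[OF A K] in_K)
  from factor_up_to[OF A A AK tR f natural_module_hom[OF A K] ft ker] obtain \<phi>
    where \<phi>: "\<phi> \<in> module_hom R A (FactModule A K)"
      and \<phi>_eq: "\<And>x y. \<lbrakk>x \<in> carrier A; y \<in> carrier A; f x = t \<odot>\<^bsub>A\<^esub> y\<rbrakk> \<Longrightarrow> \<phi> y = K +>\<^bsub>A\<^esub> x"
    by blast
  have "\<phi> (f x) = t \<odot>\<^bsub>FactModule A K\<^esub> (K +>\<^bsub>A\<^esub> x)" if "x \<in> carrier A" for x
    using that tR \<phi>_eq[of "t \<odot>\<^bsub>A\<^esub> x" "f x"]
    by (simp add: module_hom_smult[OF f] fc smult_FactModule[OF A K])
  then have \<phi>_epi: "u_S_epi R S A (FactModule A K) \<phi>"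
    unfolding u_S_epi_iff[OF A AK] carrier_FactModule using \<phi> t fc by blast
  from pp K obtain s where s: "s \<in> S"
    and "\<forall>f. u_S_epi R S A (FactModule A K) f \<longrightarrow>
      (\<exists>h\<in>module_hom R A A. \<forall>y\<in>carrier A. s \<odot>\<^bsub>FactModule A K\<^esub> f y = K +>\<^bsub>A\<^esub> h y)"
    unfolding u_S_pseudo_projective_def by blast
  with \<phi>_epi obtain h where h: "h \<in> module_hom R A A"
    and lift: "\<forall>y\<in>carrier A. s \<odot>\<^bsub>FactModule A K\<^esub> \<phi> y = K +>\<^bsub>A\<^esub> h y"
    by blast
  have sR: "s \<in> carrier R" using s subset by auto
  note hc = module_hom_closed[OF h]
  have fh: "f (h y) = (s \<otimes> t) \<odot>\<^bsub>A\<^esub> y" if y: "y \<in> carrier A" for y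
  proof -
    obtain x where x: "x \<in> carrier A" "f x = t \<odot>\<^bsub>A\<^esub> y" using ft[OF y] by blast
    have "K +>\<^bsub>A\<^esub> h y = K +>\<^bsub>A\<^esub> (s \<odot>\<^bsub>A\<^esub> x)"
      using bspec[OF lift y] \<phi>_eq[OF x(1) y x(2)] x sR by (simp add: smult_FactModule[OF A K])
    then have "h y \<ominus>\<^bsub>A\<^esub> s \<odot>\<^bsub>A\<^esub> x \<in> K"
      using x y sR by (simp add: coset_eq_iff_diff_mem[OF A K] hc)
    then have "f (h y) \<ominus>\<^bsub>A\<^esub> f (s \<odot>\<^bsub>A\<^esub> x) = \<zero>\<^bsub>A\<^esub>"
      using x y sR by (simp add: in_K module_hom_minus[OF A A f] hc)
    then have "f (h y) = s \<odot>\<^bsub>A\<^esub> f x"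
      using x y sR tR by (simp add: A.M.minus_eq_zero_iff module_hom_smult[OF f] hc fc)
    then show ?thesis using x y sR tR by (simp add: A.smult_assoc1)
  qed
  have st: "s \<otimes> t \<in> S" and stR: "s \<otimes> t \<in> carrier R" using m_closed[OF s t] subset by auto
  define k where "k x = (s \<otimes> t) \<odot>\<^bsub>A\<^esub> x \<ominus>\<^bsub>A\<^esub> h (f x)" for x
  have k: "k \<in> module_hom R A A"
    unfolding k_def
    by (rule module_hom_diff[OF A A smult_module_hom[OF A stR] module_hom_comp[OF f h]])
  have "f (k x) = \<zero>\<^bsub>A\<^esub>" if "x \<in> carrier A" for x
    using that stR by (simp add: k_def module_hom_minus[OF A A f] hc fc fh module_hom_smult[OF f]
        A.M.minus_eq_zero_iff)
  then have kK: "k \<in> module_hom R A (A\<lparr>carrier := K\<rparr>)"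
    using k by (intro module_homI)
      (simp_all add: in_K module_hom_closed[OF k] module_hom_add[OF k] module_hom_smult[OF k])
  have "k x = (s \<otimes> t) \<odot>\<^bsub>A\<lparr>carrier := K\<rparr>\<^esub> x" if "x \<in> carrier (A\<lparr>carrier := K\<rparr>)" for x
    using that stR module_hom_zero[OF A A h] by (simp add: in_K k_def A.M.minus_zero_right)
  then have "\<exists>s\<in>S. \<exists>k\<in>module_hom R A (A\<lparr>carrier := K\<rparr>).
      \<forall>x\<in>carrier (A\<lparr>carrier := K\<rparr>). k x = s \<odot>\<^bsub>A\<lparr>carrier := K\<rparr>\<^esub> x"
    by (intro bexI[OF _ st] bexI[OF _ kK] ballI)
  with u_S_short_exact_kernel[OF A A epi] epi show ?thesis
    unfolding u_S_split_epi_def u_S_split_def K_def by (intro conjI)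
qed

end

theorem proposition2p3:
  fixes R :: "('r, 'x) ring_scheme" and S :: "'r set"
  assumes "cring R" and "\<one>\<^bsub>R\<^esub> \<noteq> \<zero>\<^bsub>R\<^esub>" and "multiplicative_subset S R"
  shows
    "(\<forall>(A :: ('r, 'a, 'm) module_scheme) (B :: ('r, 'b, 'n) module_scheme)
        (C :: ('r, 'c, 'p) module_scheme) f g.
        module R A \<and> module R B \<and> module R C \<and> u_S_split R S A B C f g \<and>
        u_S_pseudo_projective R S B \<longrightarrow>
        u_S_pseudo_projective R S A \<and> u_S_pseudo_projective R S C) \<and>
     (\<forall>(A :: ('r, 'a, 'm) module_scheme) (B :: ('r, 'b, 'n) module_scheme).
        module R A \<and> module R B \<and> u_S_pseudo_projective R S (direct_sum A B) \<longrightarrow>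
        u_S_pseudo_projective R S A \<and> u_S_pseudo_projective R S B) \<and>
     (\<forall>(A :: ('r, 'a, 'm) module_scheme) (B :: ('r, 'b, 'n) module_scheme) f.
        module R A \<and> module R B \<and> u_S_iso R S A B f \<longrightarrow>
        (u_S_pseudo_projective R S A \<longleftrightarrow> u_S_pseudo_projective R S B)) \<and>
     (\<forall>(A :: ('r, 'a, 'm) module_scheme) f.
        module R A \<and> u_S_pseudo_projective R S A \<and> u_S_epi R S A A f \<longrightarrow>
        u_S_split_epi R S A A f)"
proof -
  interpret multiplicative_subset S R by fact
  show ?thesis
  proof (intro conjI allI impI; elim conjE)
    fix A :: "('r, 'a, 'm) module_scheme" and B :: "('r, 'b, 'n) module_scheme"
      and C :: "('r, 'c, 'p) module_scheme" and f g
    assume A: "module R A" and B: "module R B" and C: "module R C" and split: "u_S_split R S A B C f g"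
      and pp: "u_S_pseudo_projective R S B"
    show "u_S_pseudo_projective R S A"
      by (rule pseudo_projective_retract[OF A B retract_up_to_split_left[OF split] pp])
    show "u_S_pseudo_projective R S C"
      by (rule pseudo_projective_retract[OF C B retract_up_to_split_right[OF A B C split] pp])
  next
    fix A :: "('r, 'a, 'm) module_scheme" and B :: "('r, 'b, 'n) module_scheme"
    assume A: "module R A" and B: "module R B"
      and pp: "u_S_pseudo_projective R S (direct_sum A B)"
    note sum = direct_sum_is_module[OF A B] and retr = retract_up_to_direct_sum[OF A B]
    show "u_S_pseudo_projective R S A"
      by (rule pseudo_projective_retract[OF A sum retr(1) pp])
    show "u_S_pseudo_projective R S B"
      by (rule pseudo_projective_retract[OF B sum retr(2) pp])
  next
    fix A :: "('r, 'a, 'm) module_scheme" and B :: "('r, 'b, 'n) module_scheme" and f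
    assume A: "module R A" and B: "module R B" and iso: "u_S_iso R S A B f"
    note retr = retract_up_to_iso[OF A B iso]
    show "u_S_pseudo_projective R S A \<longleftrightarrow> u_S_pseudo_projective R S B"
      using pseudo_projective_retract[OF A B retr(1)] pseudo_projective_retract[OF B A retr(2)]
      by (rule iffI[rotated])
  next
    fix A :: "('r, 'a, 'm) module_scheme" and f
    assume "module R A" and "u_S_pseudo_projective R S A" and "u_S_epi R S A A f"
    then show "u_S_split_epi R S A A f"
      by (rule pseudo_projective_epi_splits)
  qed
qed

end
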